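(* Let $L$ be a finite lattice. Then $L$ is planar if and only if $L$ has a complementary order relation.
   Context: "Order" means strict partial order (irreflexive and transitive); $<$ is the order of the lattice and $\prec$ its covering relation. A finite ordered set $(P,<)$ has a complementary order relation $\lambda$ if $\lambda$ is a strict partial order on $P$ such that any two distinct elements of $P$ are comparable by exactly one of $<$ and $\lambda$. Points of $\mathbb{R}^2$ are written $u=(u_x,u_y)$, and $\overline{pq}$ is the straight line segment from $p$ to $q$. A diagram is a finite ordered set $H$ whose elements are distinct points of $\mathbb{R}^2$ such that for each covering $p\prec q$ in $H$ we have $p_y<q_y$ ($y$-isotone property) and $\overline{pq}\cap H=\{p,q\}$ (noninterference property). A diagram $H$ is planar if any two distinct covering segments $\overline{pq}$, $\overline{p'q'}$ ($p\prec q$, $p'\prec q'$ in $H$) are disjoint or intersect only at their endpoints. A planar lattice diagram is a planar diagram that is a lattice as an ordered set. A finite lattice $L$ is planar if it is isomorphic to some planar lattice diagram. *)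

theory Defs
  imports "HOL-Analysis.Analysis" "HOL-Algebra.Lattice"
begin

text \<open>
  Finite ordered sets and lattices are the carrier-based ones of \<open>HOL-Algebra\<close>.  The strict
  order of \<open>L\<close> is the strict part \<open>\<sqsubset>\<^bsub>L\<^esub>\<close> of its reflexive order.
\<close>

definition covers :: "('a, 'b) gorder_scheme \<Rightarrow> 'a \<Rightarrow> 'a \<Rightarrow> bool"
  where "covers L p q \<longleftrightarrow> p \<in> carrier L \<and> q \<in> carrier L \<and> p \<sqsubset>\<^bsub>L\<^esub> q \<and>
    \<not> (\<exists>z\<in>carrier L. p \<sqsubset>\<^bsub>L\<^esub> z \<and> z \<sqsubset>\<^bsub>L\<^esub> q)"

definition order_isomorphic :: "('a, 'b) gorder_scheme \<Rightarrow> ('c, 'd) gorder_scheme \<Rightarrow> bool"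
  where "order_isomorphic L M \<longleftrightarrow>
    (\<exists>f. bij_betw f (carrier L) (carrier M) \<and> order_emb L M f)"

definition strict_order_on :: "'a set \<Rightarrow> ('a \<Rightarrow> 'a \<Rightarrow> bool) \<Rightarrow> bool"
  where "strict_order_on A R \<longleftrightarrow> irreflp_on A R \<and> transp_on A R"

text \<open>The inequality of truth values below expresses exclusive disjunction.\<close>

definition complementary_order ::
    "('a, 'b) gorder_scheme \<Rightarrow> ('a \<Rightarrow> 'a \<Rightarrow> bool) \<Rightarrow> bool"
  where "complementary_order L R \<longleftrightarrow> strict_order_on (carrier L) R \<and>
    (\<forall>x\<in>carrier L. \<forall>y\<in>carrier L. x \<noteq> y \<longrightarrow>
      (x \<sqsubset>\<^bsub>L\<^esub> y \<or> y \<sqsubset>\<^bsub>L\<^esub> x) \<noteq> (R x y \<or> R y x))"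

text \<open>Points of the plane are pairs; the y-coordinate is \<^const>\<open>snd\<close>.\<close>

locale diagram = partial_order H for H :: "(real \<times> real) gorder" (structure) +
  assumes finite_carrier: "finite (carrier H)"
    and y_isotone: "covers H p q \<Longrightarrow> snd p < snd q"
    and noninterference: "covers H p q \<Longrightarrow> closed_segment p q \<inter> carrier H = {p, q}"

locale planar_diagram = diagram +
  assumes planarity: "\<lbrakk>covers H p q; covers H p' q'; closed_segment p q \<noteq> closed_segment p' q'\<rbrakk>
    \<Longrightarrow> closed_segment p q \<inter> closed_segment p' q' \<subseteq> {p, q} \<inter> {p', q'}"

locale planar_lattice_diagram = planar_diagram + lattice H

definition planar :: "('a, 'b) gorder_scheme \<Rightarrow> bool"
  where "planar L \<longleftrightarrow> (\<exists>H. planar_lattice_diagram H \<and> order_isomorphic L H)"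

end

theory Submission
  imports Defs
begin

text \<open>
  If \<open>\<lambda>\<close> is a complementary order, then the unions of \<open><\<close> with \<open>\<lambda>\<close> and with its converse are two
  linear orders whose intersection is \<open><\<close>. With \<open>a\<close>, \<open>b\<close> the ranks in them, the points
  \<open>(a - b, a + b)\<close> form a planar diagram.

  Conversely, in a planar lattice diagram every maximal chain traces out the graph of a continuous
  function of the height. By planarity two such graphs meet only along common elements or edges,
  so the graphs through two incomparable elements \<open>x\<close>, \<open>y\<close> do not meet at heights between those of
  \<open>x\<close> and \<open>y\<close>. By the intermediate value theorem one of them is to the left of the other in this
  whole range, and ``left of'' is the complementary order.
\<close>

section \<open>From a complementary order to a planar diagram\<close>

text \<open>In the mixed case \<open>S x y\<close>, \<open>R y z\<close>, exclusivity gives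
  \<open>x \<noteq> z\<close>. Moreover \<open>S z x\<close> would yield \<open>S z y\<close>,
  clashing with \<open>R y z\<close>, and \<open>R z x\<close> would yield \<open>R y x\<close>,
  clashing with \<open>S x y\<close>. So \<open>x\<close> must precede \<open>z\<close>. The other
  mixed case is alike.\<close>

lemma complementary_union_transp_on:
  assumes "strict_order_on A S" "strict_order_on A R"
    and "\<And>x y. \<lbrakk>x \<in> A; y \<in> A; x \<noteq> y\<rbrakk> \<Longrightarrow> (S x y \<or> S y x) \<noteq> (R x y \<or> R y x)"
  shows "transp_on A (\<lambda>x y. S x y \<or> R x y)"
proof (rule transp_onI)
  have irr: "\<not> S x x" "\<not> R x x" if "x \<in> A" for x
    using assms(1,2) that by (auto simp: strict_order_on_def irreflp_on_def)
  have tr: "S x y \<Longrightarrow> S y z \<Longrightarrow> S x z" "R x y \<Longrightarrow> R y z \<Longrightarrow> R x z"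
    if "x \<in> A" "y \<in> A" "z \<in> A" for x y z
    using assms(1,2) that by (auto simp: strict_order_on_def dest: transp_onD)
  show "S x z \<or> R x z" if A: "x \<in> A" "y \<in> A" "z \<in> A" and "S x y \<or> R x y" "S y z \<or> R y z" for x y z
    using that(4,5) A irr tr assms(3) by (metis (full_types))
qed

text \<open>The rank counts predecessors: by transitivity those of \<open>x\<close> are among those
  of \<open>y\<close>, and \<open>x\<close> itself is a new one by irreflexivity.\<close>

lemma strict_order_rank:
  assumes "finite A" "strict_order_on A T"
  obtains a :: "'a \<Rightarrow> real" where "\<And>x y. \<lbrakk>x \<in> A; y \<in> A; T x y\<rbrakk> \<Longrightarrow> a x < a y"
proof
  fix x y assume xy: "x \<in> A" "y \<in> A" "T x y"
  have "{z \<in> A. T z x} \<subset> {z \<in> A. T z y}"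
    using assms(2) xy unfolding strict_order_on_def
    by (auto dest: transp_onD irreflp_onD)
  then show "real (card {z \<in> A. T z x}) < real (card {z \<in> A. T z y})"
    using assms(1) by (simp add: psubset_card_mono)
qed

section \<open>The cone order on the plane\<close>

text \<open>This is the product order of the plane turned by 45 degrees: neither
  \<open>snd + fst\<close> nor \<open>snd - fst\<close> decreases from \<open>p\<close> to
  \<open>q\<close>.\<close>

definition cone_le :: "real \<times> real \<Rightarrow> real \<times> real \<Rightarrow> bool"
  where "cone_le p q \<longleftrightarrow> \<bar>fst q - fst p\<bar> \<le> snd q - snd p"

definition cone_order :: "(real \<times> real) set \<Rightarrow> (real \<times> real) gorder"
  where "cone_order A = \<lparr>carrier = A, eq = (=), le = cone_le\<rparr>"

lemma cone_order_simps [simp]: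
  "carrier (cone_order A) = A" "(p \<sqsubseteq>\<^bsub>cone_order A\<^esub> q) = cone_le p q"
  "(p .=\<^bsub>cone_order A\<^esub> q) = (p = q)"
  by (simp_all add: cone_order_def)

lemma cone_le_antisym: "cone_le p q \<Longrightarrow> cone_le q p \<Longrightarrow> p = q"
  by (auto simp: cone_le_def prod_eq_iff)

lemma cone_le_trans: "cone_le p q \<Longrightarrow> cone_le q r \<Longrightarrow> cone_le p r"
  by (auto simp: cone_le_def)

lemma partial_order_cone_order: "partial_order (cone_order A)"
proof
  show "(.=\<^bsub>cone_order A\<^esub>) = (=)"
    by (simp add: cone_order_def)
qed (auto simp: cone_le_def prod_eq_iff)

lemma covers_cone_order:
  "covers (cone_order A) p q \<longleftrightarrow> p \<in> A \<and> q \<in> A \<and> cone_le p q \<and> p \<noteq> q \<and>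
    (\<forall>z\<in>A. cone_le p z \<longrightarrow> cone_le z q \<longrightarrow> z = p \<or> z = q)"
  by (auto simp: covers_def lless_def)

text \<open>Both \<open>w - p\<close> and \<open>q - w\<close> are nonnegative multiples of
  \<open>q - p\<close>, and the cone is closed under such scaling.\<close>

lemma cone_le_closed_segment:
  assumes "cone_le p q" "w \<in> closed_segment p q"
  shows "cone_le p w" "cone_le w q"
proof -
  obtain u where u: "0 \<le> u" "u \<le> 1" and w: "w = (1 - u) *\<^sub>R p + u *\<^sub>R q"
    using assms(2) by (auto simp: in_segment)
  have "fst w - fst p = u * (fst q - fst p)" "snd w - snd p = u * (snd q - snd p)"
    "fst q - fst w = (1 - u) * (fst q - fst p)" "snd q - snd w = (1 - u) * (snd q - snd p)"
    by (simp_all add: w algebra_simps)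
  with u assms(1) show "cone_le p w" "cone_le w q"
    by (simp_all add: cone_le_def abs_mult mult_left_mono)
qed

text \<open>A common point other than \<open>p\<close> puts both segments on the same ray from
  \<open>p\<close>, so the shorter one lies in the longer one.\<close>

lemma closed_segments_meet_same_start:
  fixes p q q' w :: "'a::real_vector"
  assumes "w \<in> closed_segment p q" "w \<in> closed_segment p q'" "w \<noteq> p"
  shows "q \<in> closed_segment p q' \<or> q' \<in> closed_segment p q"
proof -
  obtain u where u: "0 \<le> u" "u \<le> 1" "w = p + u *\<^sub>R (q - p)"
    using assms(1) by (auto simp: in_segment algebra_simps)
  obtain v where v: "0 \<le> v" "v \<le> 1" "w = p + v *\<^sub>R (q' - p)"
    using assms(2) by (auto simp: in_segment algebra_simps)
  have pos: "u > 0" "v > 0"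
    using u v assms(3) by (auto simp: less_le)
  have eq: "u *\<^sub>R (q - p) = v *\<^sub>R (q' - p)"
    using u(3) v(3) by simp
  have in_seg: "b \<in> closed_segment p c"
    if "s *\<^sub>R (b - p) = t *\<^sub>R (c - p)" "0 < s" "0 < t" "t \<le> s" for b c s t
  proof -
    have "(1 / s) *\<^sub>R (s *\<^sub>R (b - p)) = (1 / s) *\<^sub>R (t *\<^sub>R (c - p))"
      using that(1) by simp
    then have "b = p + (t / s) *\<^sub>R (c - p)"
      using that(2) by (simp add: diff_eq_eq add.commute)
    then have "b = (1 - t / s) *\<^sub>R p + (t / s) *\<^sub>R c"
      by (simp add: scaleR_diff_left scaleR_diff_right)
    then show ?thesis
      using that by (auto simp: in_segment intro!: exI[of _ "t / s"])
  qed
  show ?thesis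
    using in_seg[OF eq] in_seg[OF eq[symmetric]] pos by linarith
qed

text \<open>The join of \<open>x\<close> and \<open>x'\<close> serves as \<open>s\<close>. This is
  how the lattice property will exclude crossing edges.\<close>

lemma (in lattice) interpolate:
  assumes "x \<in> carrier L" "x' \<in> carrier L" "y \<in> carrier L" "y' \<in> carrier L"
    and "x \<sqsubseteq> y" "x \<sqsubseteq> y'" "x' \<sqsubseteq> y" "x' \<sqsubseteq> y'"
  obtains s where "s \<in> carrier L" "x \<sqsubseteq> s" "x' \<sqsubseteq> s" "s \<sqsubseteq> y" "s \<sqsubseteq> y'"
proof -
  obtain s where "least L s (Upper L {x, x'})"
    using sup_of_two_exists assms by blast
  with assms show thesis
    by (intro that[of s]) (auto simp: least_def Upper_def)
qed

text \<open>If two covering segments meet in \<open>w\<close>, then both lower ends are below \<open>w\<close> and both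
  upper ends above it in the cone order of the whole plane, so some lattice element interpolates
  and must be an end of both.\<close>

lemma planar_lattice_diagram_cone_order:
  assumes "finite A" "lattice (cone_order A)"
  shows "planar_lattice_diagram (cone_order A)"
proof -
  interpret lattice "cone_order A" by fact
  have inter: "closed_segment p q \<inter> A = {p, q}" if "covers (cone_order A) p q" for p q
  proof -
    have "z = p \<or> z = q" if "z \<in> closed_segment p q" "z \<in> A" for z
      using \<open>covers (cone_order A) p q\<close> cone_le_closed_segment[of p q z] that
      unfolding covers_cone_order by blast
    moreover have "p \<in> A" "q \<in> A"
      using that by (simp_all add: covers_cone_order)
    ultimately show ?thesis by auto
  qed
  have plan: "w \<in> {p, q} \<inter> {p', q'}"
    if c: "covers (cone_order A) p q" "covers (cone_order A) p' q'"
      and ne: "closed_segment p q \<noteq> closed_segment p' q'"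
      and w: "w \<in> closed_segment p q" "w \<in> closed_segment p' q'" for p q p' q' w
  proof -
    have A: "p \<in> A" "q \<in> A" "p' \<in> A" "q' \<in> A" and pq: "cone_le p q" "cone_le p' q'"
      and distinct: "p \<noteq> q" "p' \<noteq> q'"
      using c by (auto simp: covers_cone_order)
    have le: "cone_le p w" "cone_le w q" "cone_le p' w" "cone_le w q'"
      using pq w cone_le_closed_segment by blast+
    then have "cone_le p q'" "cone_le p' q"
      using cone_le_trans by blast+
    then obtain s where s: "s \<in> A" "cone_le p s" "cone_le p' s" "cone_le s q" "cone_le s q'"
      using interpolate[of p p' q q'] A pq by (simp only: cone_order_simps) blast
    then have "s = p \<or> s = q" "s = p' \<or> s = q'"
      using c unfolding covers_cone_order by blast+
    then consider "p = p'" | "q = q'" | "p = q'" | "q = p'"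
      by blast
    then show ?thesis
    proof cases
      case 1
      have "w = p"
      proof (rule ccontr)
        \<comment> \<open>Otherwise the upper end of one edge lies on the other edge. That edge
          contains no elements but its ends, so the two upper ends coincide and the segments are
          equal.\<close>
        assume "w \<noteq> p"
        with closed_segments_meet_same_start[of w p q q'] w 1
        have "q \<in> closed_segment p' q' \<inter> A \<or> q' \<in> closed_segment p q \<inter> A"
          using A by blast
        then have "q \<in> {p', q'} \<or> q' \<in> {p, q}"
          unfolding inter[OF c(1)] inter[OF c(2)] .
        with ne 1 distinct show False by auto
      qed
      with 1 show ?thesis by simp
    next
      case 2
      have "w = q"
      proof (rule ccontr)
        assume "w \<noteq> q"
        with closed_segments_meet_same_start[of w q p p'] w 2
        have "p \<in> closed_segment p' q' \<or> p' \<in> closed_segment p q"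
          by (simp add: closed_segment_commute)
        then have "p \<in> closed_segment p' q' \<inter> A \<or> p' \<in> closed_segment p q \<inter> A"
          using A by blast
        then have "p \<in> {p', q'} \<or> p' \<in> {p, q}"
          unfolding inter[OF c(1)] inter[OF c(2)] .
        with ne 2 distinct show False by auto
      qed
      with 2 show ?thesis by simp
    next
      case 3
      \<comment> \<open>Here \<open>w\<close> lies both above \<open>p\<close> and below
        \<open>q' = p\<close> in the cone order.\<close>
      then have "w = p" using le cone_le_antisym by blast
      with 3 show ?thesis by simp
    next
      case 4
      then have "w = q" using le cone_le_antisym by blast
      with 4 show ?thesis by simp
    qed
  qed
  show ?thesis
  proof
    fix p q assume "covers (cone_order A) p q"
    then have "cone_le p q" "p \<noteq> q"
      by (auto simp: covers_cone_order)
    then show "snd p < snd q"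
      by (cases "snd p = snd q") (auto simp: cone_le_def prod_eq_iff)
  next
    fix p q p' q'
    assume "covers (cone_order A) p q" "covers (cone_order A) p' q'"
      "closed_segment p q \<noteq> closed_segment p' q'"
    then show "closed_segment p q \<inter> closed_segment p' q' \<subseteq> {p, q} \<inter> {p', q'}"
      using plan by blast
  qed (use assms inter in simp_all)
qed

section \<open>Embedding a lattice with a complementary order in the cone order\<close>

lemma lattice_order_iso:
  assumes "lattice L" "partial_order M" "bij_betw f (carrier L) (carrier M)"
    and emb: "\<And>x y. \<lbrakk>x \<in> carrier L; y \<in> carrier L\<rbrakk> \<Longrightarrow> f x \<sqsubseteq>\<^bsub>M\<^esub> f y \<longleftrightarrow> x \<sqsubseteq>\<^bsub>L\<^esub> y"
  shows "lattice M"
proof -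
  interpret L: lattice L by fact
  interpret M: partial_order M by fact
  have M: "carrier M = f ` carrier L"
    using assms(3) by (simp add: bij_betw_def)
  show ?thesis
  proof
    fix u v assume "u \<in> carrier M" "v \<in> carrier M"
    then obtain x y where xy: "x \<in> carrier L" "y \<in> carrier L" "u = f x" "v = f y"
      using M by blast
    obtain s where "least L s (Upper L {x, y})"
      using L.sup_of_two_exists xy by blast
    with xy emb have "least M (f s) (Upper M {u, v})"
      by (auto simp: least_def Upper_def M)
    then show "\<exists>s. least M s (Upper M {u, v})" ..
    obtain i where "greatest L i (Lower L {x, y})"
      using L.inf_of_two_exists xy by blast
    with xy emb have "greatest M (f i) (Lower M {u, v})"
      by (auto simp: greatest_def Lower_def M)
    then show "\<exists>i. greatest M i (Lower M {u, v})" ..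
  qed
qed

lemma complementary_order_imp_planar:
  assumes "lattice L" and fin: "finite (carrier L)" and "complementary_order L R"
  shows "planar L"
proof -
  interpret lattice L by fact
  let ?A = "carrier L" and ?S = "\<lambda>x y. x \<sqsubset>\<^bsub>L\<^esub> y"
  have S: "strict_order_on ?A ?S"
    unfolding strict_order_on_def
  proof
    show "irreflp_on ?A ?S"
      by (simp add: irreflp_on_def lless_eq)
    show "transp_on ?A ?S"
      by (intro transp_onI) (rule lless_trans)
  qed
  have R: "strict_order_on ?A R"
    using assms(3) by (simp add: complementary_order_def)
  then have R': "strict_order_on ?A (\<lambda>x y. R y x)"
    unfolding strict_order_on_def irreflp_on_def transp_on_def by blast
  have tot: "(x \<sqsubset>\<^bsub>L\<^esub> y \<or> y \<sqsubset>\<^bsub>L\<^esub> x) \<noteq> (R x y \<or> R y x)"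
    if "x \<in> ?A" "y \<in> ?A" "x \<noteq> y" for x y
    using assms(3) that by (simp add: complementary_order_def)
  have lin: "strict_order_on ?A (\<lambda>x y. ?S x y \<or> R x y)" "strict_order_on ?A (\<lambda>x y. ?S x y \<or> R y x)"
    using complementary_union_transp_on[OF S R tot] complementary_union_transp_on[OF S R'] S R tot
    by (auto simp: strict_order_on_def irreflp_on_def)
  obtain a :: "'a \<Rightarrow> real"
    where a: "\<And>x y. \<lbrakk>x \<in> ?A; y \<in> ?A; ?S x y \<or> R x y\<rbrakk> \<Longrightarrow> a x < a y"
    using strict_order_rank[OF fin lin(1)] by blast
  obtain b :: "'a \<Rightarrow> real"
    where b: "\<And>x y. \<lbrakk>x \<in> ?A; y \<in> ?A; ?S x y \<or> R y x\<rbrakk> \<Longrightarrow> b x < b y"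
    using strict_order_rank[OF fin lin(2)] by blast
  \<comment> \<open>In these coordinates \<open>snd + fst\<close> is \<open>2 * a x\<close> and
    \<open>snd - fst\<close> is \<open>2 * b x\<close>, so the cone order compares both
    ranks.\<close>
  define f where "f = (\<lambda>x. (a x - b x, a x + b x))"
  have cone: "cone_le (f x) (f y) \<longleftrightarrow> a x \<le> a y \<and> b x \<le> b y" for x y
    by (auto simp: cone_le_def f_def)
  have emb: "cone_le (f x) (f y) \<longleftrightarrow> x \<sqsubseteq>\<^bsub>L\<^esub> y" if xy: "x \<in> ?A" "y \<in> ?A" for x y
  proof (cases "x = y")
    case False
    \<comment> \<open>The lattice order moves both ranks in the same direction, \<open>R\<close>
      moves them in opposite directions.\<close>
    with tot[OF xy] consider "?S x y" | "?S y x" | "R x y" "\<not> ?S x y" | "R y x" "\<not> ?S x y"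
      by blast
    then show ?thesis
      using False a[OF xy] a[OF xy(2,1)] b[OF xy] b[OF xy(2,1)] xy
      by cases (auto simp: cone lless_eq)
  qed (use xy in \<open>simp add: cone\<close>)
  have "inj_on f ?A"
  proof (rule inj_onI)
    fix x y assume xy: "x \<in> ?A" "y \<in> ?A" "f x = f y"
    then have "cone_le (f x) (f y)" "cone_le (f y) (f x)"
      by (simp_all add: cone_le_def)
    with xy emb show "x = y"
      by (metis weak_le_antisym eq_is_equal)
  qed
  then have bij: "bij_betw f ?A (carrier (cone_order (f ` ?A)))"
    by (simp add: bij_betw_def)
  interpret M: partial_order "cone_order (f ` ?A)"
    by (rule partial_order_cone_order)
  have "lattice (cone_order (f ` ?A))"
    using lattice_order_iso[OF \<open>lattice L\<close> M.partial_order_axioms bij] emb by simp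
  then have "planar_lattice_diagram (cone_order (f ` ?A))"
    using fin planar_lattice_diagram_cone_order by blast
  moreover have "order_isomorphic L (cone_order (f ` ?A))"
    using bij emb weak_partial_order_axioms M.weak_partial_order_axioms
    unfolding order_isomorphic_def order_emb_def by auto
  ultimately show ?thesis
    unfolding planar_def by blast
qed

section \<open>From a planar diagram to a complementary order\<close>

text \<open>Induction on the size of the interval from \<open>x\<close> to \<open>y\<close>: an
  element strictly between splits it into two smaller intervals, one lacking \<open>y\<close> and
  the other lacking \<open>x\<close>.\<close>

lemma (in partial_order) le_covers_induct [consumes 4, case_names refl covers trans]:
  assumes fin: "finite (carrier L)" and "x \<in> carrier L" "y \<in> carrier L" "x \<sqsubseteq> y"
    and r: "\<And>x. x \<in> carrier L \<Longrightarrow> P x x"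
    and c: "\<And>x y. covers L x y \<Longrightarrow> P x y"
    and t: "\<And>x y z. \<lbrakk>x \<in> carrier L; y \<in> carrier L; z \<in> carrier L; x \<sqsubseteq> y; y \<sqsubseteq> z; P x y; P y z\<rbrakk> \<Longrightarrow> P x z"
  shows "P x y"
  using assms(2-4)
proof (induction "card {z \<in> carrier L. x \<sqsubseteq> z \<and> z \<sqsubseteq> y}" arbitrary: x y rule: less_induct)
  case less
  consider "x = y" | "covers L x y" | z where "z \<in> carrier L" "x \<sqsubset> z" "z \<sqsubset> y"
    using less.prems unfolding covers_def lless_eq by blast
  then show ?case
  proof cases
    case 3
    then have "{v \<in> carrier L. x \<sqsubseteq> v \<and> v \<sqsubseteq> z} \<subset> {v \<in> carrier L. x \<sqsubseteq> v \<and> v \<sqsubseteq> y}"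
      "{v \<in> carrier L. z \<sqsubseteq> v \<and> v \<sqsubseteq> y} \<subset> {v \<in> carrier L. x \<sqsubseteq> v \<and> v \<sqsubseteq> y}"
      using less.prems weak_le_antisym le_trans unfolding lless_eq eq_is_equal by blast+
    then have "card {v \<in> carrier L. x \<sqsubseteq> v \<and> v \<sqsubseteq> z} < card {v \<in> carrier L. x \<sqsubseteq> v \<and> v \<sqsubseteq> y}"
      "card {v \<in> carrier L. z \<sqsubseteq> v \<and> v \<sqsubseteq> y} < card {v \<in> carrier L. x \<sqsubseteq> v \<and> v \<sqsubseteq> y}"
      using fin by (simp_all add: psubset_card_mono)
    with less 3 t[of x z y] show ?thesis
      by (simp add: lless_eq)
  qed (use r c less.prems in auto)
qed

section \<open>Maximal chains as graphs over the height\<close>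

context planar_diagram
begin

lemma snd_strict_mono:
  assumes "x \<in> carrier H" "y \<in> carrier H" "x \<sqsubseteq> y" "x \<noteq> y"
  shows "snd x < snd y"
proof -
  have "x = y \<or> snd x < snd y"
    using finite_carrier assms(1-3) by (induction rule: le_covers_induct) (auto dest: y_isotone)
  with assms show ?thesis by simp
qed

lemma snd_mono: "x \<in> carrier H \<Longrightarrow> y \<in> carrier H \<Longrightarrow> x \<sqsubseteq> y \<Longrightarrow> snd x \<le> snd y"
  using snd_strict_mono[of x y] by fastforce

text \<open>The coordinate \<^term>\<open>F t\<close> is the abscissa at height \<open>t\<close> of the polygonal line through the maximal
  chain \<open>C\<close> of the interval from \<open>p\<close> to \<open>q\<close>. The case \<open>r = s\<close> is only needed for \<open>p = q\<close>.\<close>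

definition chain_path ::
    "real \<times> real \<Rightarrow> real \<times> real \<Rightarrow> (real \<times> real) set \<Rightarrow> (real \<Rightarrow> real) \<Rightarrow> bool"
  where "chain_path p q C F \<longleftrightarrow> C \<subseteq> carrier H \<and> p \<in> C \<and> q \<in> C \<and> (\<forall>c\<in>C. p \<sqsubseteq> c \<and> c \<sqsubseteq> q) \<and>
    (\<forall>c\<in>C. \<forall>d\<in>C. c \<sqsubseteq> d \<or> d \<sqsubseteq> c) \<and> (\<forall>c\<in>C. F (snd c) = fst c) \<and>
    continuous_on {snd p..snd q} F \<and>
    (\<forall>t\<in>{snd p..snd q}. \<exists>r\<in>C. \<exists>s\<in>C. (r = s \<or> covers H r s) \<and> (F t, t) \<in> closed_segment r s)"

lemma chain_path_height:
  assumes "chain_path p q C F" "x \<in> C"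
  shows "snd x \<in> {snd p..snd q}"
proof -
  have "p \<in> carrier H" "q \<in> carrier H" "x \<in> carrier H" "p \<sqsubseteq> x" "x \<sqsubseteq> q"
    using assms by (auto simp: chain_path_def)
  then show ?thesis
    using snd_mono[of p x] snd_mono[of x q] by simp
qed

lemma chain_path_refl: "p \<in> carrier H \<Longrightarrow> chain_path p p {p} (\<lambda>_. fst p)"
  by (auto simp: chain_path_def)

text \<open>The function interpolates linearly between the ends; the denominator is positive because
  heights increase along edges.\<close>

lemma chain_path_covers:
  assumes "covers H p q"
  shows "chain_path p q {p, q} (\<lambda>t. fst p + (t - snd p) / (snd q - snd p) * (fst q - fst p))"
proof -
  have "snd p < snd q"
    using assms by (rule y_isotone)
  moreover have "(fst p + (t - snd p) / (snd q - snd p) * (fst q - fst p), t) \<in> closed_segment p q"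
    if "t \<in> {snd p..snd q}" for t
    unfolding in_segment
  proof (intro exI conjI)
    show "(fst p + (t - snd p) / (snd q - snd p) * (fst q - fst p), t) =
      (1 - (t - snd p) / (snd q - snd p)) *\<^sub>R p + ((t - snd p) / (snd q - snd p)) *\<^sub>R q"
    proof -
      have "(1 - u) * fst p + u * fst q = fst p + u * (fst q - fst p)"
        "(1 - u) * snd p + u * snd q = snd p + u * (snd q - snd p)" for u
        by (simp_all add: algebra_simps)
      then show ?thesis
        using \<open>snd p < snd q\<close> by (simp only: prod_eq_iff fst_add snd_add fst_scaleR snd_scaleR real_scaleR_def fst_conv snd_conv) simp
    qed
  qed (use that \<open>snd p < snd q\<close> in \<open>auto simp: field_simps\<close>)
  ultimately show ?thesis
    using assms by (auto simp: chain_path_def covers_def lless_eq intro!: continuous_intros)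
qed

text \<open>The height ranges overlap only in \<open>snd q\<close>, where both functions take the
  value \<open>fst q\<close>. Elements of \<open>D\<close> other than \<open>q\<close> lie strictly
  higher, so the case distinction selects the right function at every element.\<close>

lemma chain_path_join:
  assumes "chain_path p q C F" "chain_path q r D G"
  shows "chain_path p r (C \<union> D) (\<lambda>t. if t \<le> snd q then F t else G t)"
proof -
  have C: "C \<subseteq> carrier H" "p \<in> C" "q \<in> C" "\<And>c. c \<in> C \<Longrightarrow> p \<sqsubseteq> c \<and> c \<sqsubseteq> q"
    "\<And>c d. c \<in> C \<Longrightarrow> d \<in> C \<Longrightarrow> c \<sqsubseteq> d \<or> d \<sqsubseteq> c" "\<And>c. c \<in> C \<Longrightarrow> F (snd c) = fst c"
    "continuous_on {snd p..snd q} F"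
    "\<And>t. t \<in> {snd p..snd q} \<Longrightarrow> \<exists>r\<in>C. \<exists>s\<in>C. (r = s \<or> covers H r s) \<and> (F t, t) \<in> closed_segment r s"
    using assms(1) by (auto simp: chain_path_def)
  have D: "D \<subseteq> carrier H" "q \<in> D" "r \<in> D" "\<And>c. c \<in> D \<Longrightarrow> q \<sqsubseteq> c \<and> c \<sqsubseteq> r"
    "\<And>c d. c \<in> D \<Longrightarrow> d \<in> D \<Longrightarrow> c \<sqsubseteq> d \<or> d \<sqsubseteq> c" "\<And>c. c \<in> D \<Longrightarrow> G (snd c) = fst c"
    "continuous_on {snd q..snd r} G"
    "\<And>t. t \<in> {snd q..snd r} \<Longrightarrow> \<exists>r\<in>D. \<exists>s\<in>D. (r = s \<or> covers H r s) \<and> (G t, t) \<in> closed_segment r s"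
    using assms(2) by (auto simp: chain_path_def)
  have pqr: "snd p \<le> snd q" "snd q \<le> snd r"
    using chain_path_height[OF assms(1) C(3)] chain_path_height[OF assms(2) D(2)] by simp_all
  have CD: "c \<sqsubseteq> d" if "c \<in> C" "d \<in> D" for c d
    using that C(1,3) C(4)[of c] D(1) D(4)[of d] le_trans[of c q d] by blast
  have val: "(if snd c \<le> snd q then F (snd c) else G (snd c)) = fst c" if "c \<in> C \<union> D" for c
  proof (cases "c \<in> C")
    case True
    then show ?thesis using C(6) chain_path_height[OF assms(1), of c] by simp
  next
    case False
    then have "c \<in> D" "c \<noteq> q" using that C by auto
    then have "snd q < snd c" using D(1,2) D(4)[of c] by (intro snd_strict_mono) auto
    then show ?thesis using D(6) \<open>c \<in> D\<close> by simp
  qed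
  have "continuous_on ({snd p..snd q} \<union> {snd q..snd r}) (\<lambda>t. if t \<le> snd q then F t else G t)"
    using C(7) D(7) C(6)[OF C(3)] D(6)[OF D(2)] by (intro continuous_on_cases) auto
  then have cont: "continuous_on {snd p..snd r} (\<lambda>t. if t \<le> snd q then F t else G t)"
    using pqr by (simp add: ivl_disj_un_two_touch)
  have seg: "\<exists>r\<in>C \<union> D. \<exists>s\<in>C \<union> D. (r = s \<or> covers H r s) \<and>
      (if t \<le> snd q then F t else G t, t) \<in> closed_segment r s" if "t \<in> {snd p..snd r}" for t
  proof (cases "t \<le> snd q")
    case True
    then show ?thesis using C(8)[of t] that by auto
  next
    case False
    then show ?thesis using D(8)[of t] that by auto
  qed
  have "p \<sqsubseteq> c \<and> c \<sqsubseteq> r" if "c \<in> C \<union> D" for c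
    using that C(2) C(4)[of c] D(3) D(4)[of c] CD[of p c] CD[of c r] by blast
  moreover have "c \<sqsubseteq> d \<or> d \<sqsubseteq> c" if "c \<in> C \<union> D" "d \<in> C \<union> D" for c d
    using that C(5) D(5) CD by blast
  ultimately show ?thesis
    unfolding chain_path_def using C(1,2) D(1,3) val cont seg by auto
qed

lemma chain_path_exists:
  assumes "p \<in> carrier H" "q \<in> carrier H" "p \<sqsubseteq> q"
  obtains C F where "chain_path p q C F"
proof -
  have "\<exists>C F. chain_path p q C F"
    using finite_carrier assms
    by (induction rule: le_covers_induct) (blast intro: chain_path_refl chain_path_covers chain_path_join)+
  then show thesis using that by blast
qed

section \<open>Meeting points of paths\<close>

text \<open>By planarity, paths that meet at height \<open>t\<close> share an element there or a
  whole edge around it. A shared element \<open>z\<close> at a height between those of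
  \<open>x\<close> and \<open>y\<close> gives \<open>x \<sqsubseteq> z\<close> and
  \<open>z \<sqsubseteq> y\<close> along the two chains.\<close>

lemma chain_path_meet_le:
  assumes "chain_path p q C F" "chain_path p q D G" "t \<in> {snd p..snd q}" "F t = G t"
    and "x \<in> C" "y \<in> D" "snd x \<le> t" "t \<le> snd y"
  shows "x \<sqsubseteq> y"
proof -
  have C: "C \<subseteq> carrier H" "\<And>c d. c \<in> C \<Longrightarrow> d \<in> C \<Longrightarrow> c \<sqsubseteq> d \<or> d \<sqsubseteq> c"
    and D: "D \<subseteq> carrier H" "\<And>c d. c \<in> D \<Longrightarrow> d \<in> D \<Longrightarrow> c \<sqsubseteq> d \<or> d \<sqsubseteq> c"
    using assms(1,2) by (auto simp: chain_path_def)
  have below: "c \<sqsubseteq> d" if "c \<in> C \<and> d \<in> C \<or> c \<in> D \<and> d \<in> D" "snd c \<le> snd d" for c d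
    using that C D snd_strict_mono[of d c] by (metis leD le_refl subsetD)
  have common: "x \<sqsubseteq> y" if "z \<in> C \<inter> D" "snd x \<le> snd z" "snd z \<le> snd y" for z
    using that below[of x z] below[of z y] assms(5,6) C(1) D(1) le_trans[of x z y] by blast
  obtain r s where rs: "r \<in> C" "s \<in> C" "r = s \<or> covers H r s" "(F t, t) \<in> closed_segment r s"
    using assms(1,3) unfolding chain_path_def by blast
  obtain r' s' where rs': "r' \<in> D" "s' \<in> D" "r' = s' \<or> covers H r' s'" "(F t, t) \<in> closed_segment r' s'"
    using assms(2,3,4) unfolding chain_path_def by (metis (no_types, lifting))
  have mem: "(F t, t) \<in> C \<inter> D \<Longrightarrow> x \<sqsubseteq> y"
    using common[of "(F t, t)"] assms(7,8) by simp
  show ?thesis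
  proof (cases "r = s \<or> r' = s'")
    case True
    \<comment> \<open>A degenerate segment makes the meeting point an element, and noninterference
      makes it an end of the other segment too.\<close>
    then have "(F t, t) \<in> carrier H"
      using rs rs' C(1) D(1) by auto
    then have "(F t, t) \<in> {r, s}" "(F t, t) \<in> {r', s'}"
      using rs(3,4) rs'(3,4) noninterference[of r s] noninterference[of r' s'] by force+
    with rs rs' mem show ?thesis by blast
  next
    case False
    then have cov: "covers H r s" "covers H r' s'"
      using rs rs' by auto
    show ?thesis
    proof (cases "closed_segment r s = closed_segment r' s'")
      case True
      \<comment> \<open>Intersecting the common segment with the carrier recovers the ends.\<close>
      then have "{r, s} = {r', s'}"
        using cov noninterference by metis
      then have CD: "r \<in> C \<inter> D" "s \<in> C \<inter> D"
        using rs rs' by auto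
      have "snd r < snd s" using cov y_isotone by blast
      have "(F t, t) \<in> closed_segment (fst r, snd r) (fst s, snd s)"
        using rs by simp
      then have "t \<in> closed_segment (snd r) (snd s)"
        using closed_segment_PairD by blast
      then have t: "snd r \<le> t" "t \<le> snd s"
        using \<open>snd r < snd s\<close> by (auto simp: closed_segment_eq_real_ivl)
      show ?thesis
      proof (cases "snd x \<le> snd r")
        case True
        then show ?thesis using common[of r] CD t assms(8) by simp
      next
        \<comment> \<open>An element of \<open>C\<close> above \<open>r\<close> but not above height
          \<open>t\<close> can only be \<open>s\<close>, since \<open>s\<close> covers
          \<open>r\<close>.\<close>
        case False
        then have "r \<sqsubseteq> x" "x \<noteq> r" "x \<sqsubseteq> s"
          using below CD assms(5,7) t by auto
        then have "x = s"
          using cov(1) C(1) assms(5) unfolding covers_def lless_eq by blast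
        then show ?thesis using common[of s] CD assms(7,8) by simp
      qed
    next
      case False
      then have "(F t, t) \<in> {r, s} \<inter> {r', s'}"
        using planarity[OF cov] rs rs' by blast
      with rs rs' mem show ?thesis by blast
    qed
  qed
qed

definition incomp where "incomp x y \<longleftrightarrow> \<not> x \<sqsubseteq> y \<and> \<not> y \<sqsubseteq> x"

text \<open>If the sides changed, the intermediate value theorem would give a zero of
  \<open>F - G\<close> between \<open>t\<close> and \<open>t'\<close>.\<close>

lemma chain_paths_same_side:
  assumes "chain_path p q C F" "chain_path p q D G" and I: "is_interval I" "I \<subseteq> {snd p..snd q}"
    and ne: "\<And>t. t \<in> I \<Longrightarrow> F t \<noteq> G t" and t: "t \<in> I" "t' \<in> I" and less: "F t < G t"
  shows "F t' < G t'"
proof (rule ccontr)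
  assume *: "\<not> F t' < G t'"
  have sub: "closed_segment t t' \<subseteq> I"
    using I(1) t by (simp add: closed_segment_subset is_interval_convex)
  have "continuous_on {snd p..snd q} F" "continuous_on {snd p..snd q} G"
    using assms(1,2) by (auto simp: chain_path_def)
  then have "continuous_on (closed_segment t t') (\<lambda>t. F t - G t)"
    using sub I(2) by (intro continuous_intros) (meson continuous_on_subset order_trans)+
  moreover have "0 \<in> closed_segment (F t - G t) (F t' - G t')"
    using less * by (simp add: closed_segment_eq_real_ivl)
  ultimately obtain u where "u \<in> closed_segment t t'" "F u - G u = 0"
    using IVT'_closed_segment_real[of 0 "\<lambda>t. F t - G t" t t'] by blast
  then show False
    using ne sub by auto
qed

text \<open>A meeting at a height between \<open>x\<close> and \<open>y\<close> would put the lower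
  of the two below the other in the order.\<close>

lemma chain_paths_same_side_between:
  assumes "chain_path p q C F" "chain_path p q D G" "x \<in> C" "y \<in> D" "incomp x y"
    and "t \<in> closed_segment (snd x) (snd y)" "t' \<in> closed_segment (snd x) (snd y)"
  shows "F t \<noteq> G t" "F t < G t \<Longrightarrow> F t' < G t'"
proof -
  have sub: "closed_segment (snd x) (snd y) \<subseteq> {snd p..snd q}"
    using chain_path_height[OF assms(1,3)] chain_path_height[OF assms(2,4)]
    by (simp add: closed_segment_subset)
  have ne: "F t \<noteq> G t" if "t \<in> closed_segment (snd x) (snd y)" for t
  proof
    assume "F t = G t"
    moreover have "snd x \<le> t \<and> t \<le> snd y \<or> snd y \<le> t \<and> t \<le> snd x"
      using that by (auto simp: closed_segment_eq_real_ivl split: if_splits)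
    ultimately show False
      using sub that assms(3-5) chain_path_meet_le[OF assms(1,2), of t x y]
        chain_path_meet_le[OF assms(2,1), of t y x]
      unfolding incomp_def by auto
  qed
  show "F t \<noteq> G t"
    using assms(6) by (rule ne)
  show "F t' < G t'" if "F t < G t"
    using chain_paths_same_side[OF assms(1,2) is_interval_closed_segment_1 sub ne assms(6,7) that] .
qed

text \<open>Here the heights run from \<open>x\<close> to \<open>z\<close>, wherever
  \<open>y\<close> lies. If the paths met at height \<open>t\<close>, then
  \<open>x \<sqsubseteq> y\<close> or \<open>y \<sqsubseteq> z\<close> would follow, according to
  whether \<open>y\<close> is above or below that height.\<close>

lemma chain_paths_same_side_comparable:
  assumes "chain_path p q C F" "chain_path p q D G" "x \<in> C" "z \<in> C" "y \<in> D"
    and "incomp x y" "incomp y z" "x \<sqsubseteq> z"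
  shows "F (snd x) < G (snd x) \<longleftrightarrow> F (snd z) < G (snd z)"
    "G (snd x) < F (snd x) \<longleftrightarrow> G (snd z) < F (snd z)"
proof -
  have "x \<in> carrier H" "z \<in> carrier H"
    using assms(1,3,4) by (auto simp: chain_path_def)
  then have xz: "snd x \<le> snd z"
    using assms(8) snd_mono by blast
  have sub: "{snd x..snd z} \<subseteq> {snd p..snd q}"
    using chain_path_height[OF assms(1,3)] chain_path_height[OF assms(1,4)] by auto
  have ne: "F t \<noteq> G t" if t: "t \<in> {snd x..snd z}" for t
  proof
    assume eq: "F t = G t"
    have "x \<sqsubseteq> y" if "t \<le> snd y"
      using chain_path_meet_le[OF assms(1,2) _ eq assms(3,5)] t that sub by auto
    moreover have "y \<sqsubseteq> z" if "snd y \<le> t"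
      using chain_path_meet_le[OF assms(2,1) _ eq[symmetric] assms(5,4)] t that sub by auto
    ultimately show False
      using assms(6,7) unfolding incomp_def by argo
  qed
  have "is_interval {snd x..snd z}" by simp
  note side = chain_paths_same_side[OF assms(1,2) this sub ne]
    chain_paths_same_side[OF assms(2,1) this sub ne[symmetric]]
  show "F (snd x) < G (snd x) \<longleftrightarrow> F (snd z) < G (snd z)"
    "G (snd x) < F (snd x) \<longleftrightarrow> G (snd z) < F (snd z)"
    using side xz by (meson atLeastAtMost_iff order_refl)+
qed

end

section \<open>The left-of relation\<close>

lemma (in planar_lattice_diagram) complementary_order_exists:
  "\<exists>R. complementary_order H R"
proof (cases "carrier H = {}")
  \<comment> \<open>The lattice axioms admit an empty carrier, which has no top and bottom to join
    by paths.\<close>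
  case True
  then show ?thesis
    by (intro exI[of _ "\<lambda>_ _. False"])
      (simp add: complementary_order_def strict_order_on_def irreflp_on_def transp_on_def)
next
  case False
  \<comment> \<open>With top \<open>u\<close> and bottom \<open>b\<close> as common ends, all paths
    live over the same range of heights.\<close>
  obtain u where u: "u \<in> carrier H" "\<And>x. x \<in> carrier H \<Longrightarrow> x \<sqsubseteq> u"
    using finite_sup_least[OF finite_carrier subset_refl False] unfolding least_def Upper_def by blast
  obtain b where b: "b \<in> carrier H" "\<And>x. x \<in> carrier H \<Longrightarrow> b \<sqsubseteq> x"
    using finite_inf_greatest[OF finite_carrier subset_refl False] unfolding greatest_def Lower_def by blast
  have through: "\<exists>C F. chain_path b u C F \<and> x \<in> C \<and> y \<in> C"
    if xy: "x \<in> carrier H" "y \<in> carrier H" "x \<sqsubseteq> y" for x y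
  proof -
    obtain C1 F1 where 1: "chain_path b x C1 F1"
      using chain_path_exists b xy by blast
    obtain C2 F2 where 2: "chain_path x y C2 F2"
      using chain_path_exists xy by blast
    obtain C3 F3 where 3: "chain_path y u C3 F3"
      using chain_path_exists u xy by blast
    have "x \<in> C1 \<union> C2 \<union> C3" "y \<in> C1 \<union> C2 \<union> C3"
      using 2 by (auto simp: chain_path_def)
    with chain_path_join[OF chain_path_join[OF 1 2] 3] show ?thesis by blast
  qed
  \<comment> \<open>One path through each element is fixed by choice.\<close>
  obtain C F where path: "\<And>x. x \<in> carrier H \<Longrightarrow> chain_path b u (C x) (F x) \<and> x \<in> C x"
    using through[OF _ _ le_refl] by metis
  have F_snd: "F x (snd x) = fst x" if "x \<in> carrier H" for x
    using path[OF that] by (auto simp: chain_path_def)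
  define R where "R x y \<longleftrightarrow> incomp x y \<and> F x (snd x) < F y (snd x)" for x y
  \<comment> \<open>The height \<open>snd x\<close> in the definition of \<open>R\<close> may be
    replaced by any height between \<open>x\<close> and \<open>y\<close>; this makes the definition
    symmetric in the two elements.\<close>
  have R_iff: "R x y \<longleftrightarrow> F x t < F y t"
    if "x \<in> carrier H" "y \<in> carrier H" "incomp x y" "t \<in> closed_segment (snd x) (snd y)" for x y t
    using that path chain_paths_same_side_between(2)[of b u "C x" "F x" "C y" "F y" x y]
    unfolding R_def by (meson ends_in_segment)
  have incomp_sym: "incomp x y \<longleftrightarrow> incomp y x" for x y
    by (auto simp: incomp_def)
  have R_incomp: "R x y \<Longrightarrow> incomp x y" for x y
    by (simp add: R_def)
  have R_asym: "\<not> R y x" if "R x y" "x \<in> carrier H" "y \<in> carrier H" for x y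
    using that R_iff[of x y "snd x"] R_iff[of y x "snd x"] R_incomp incomp_sym
    by (metis ends_in_segment order_less_asym)
  have R_total: "R x y \<or> R y x" if "x \<in> carrier H" "y \<in> carrier H" "incomp x y" for x y
  proof -
    have "F x (snd x) \<noteq> F y (snd x)"
      using that path chain_paths_same_side_between(1)[of b u "C x" "F x" "C y" "F y" x y "snd x" "snd x"] by simp
    then show ?thesis
      using that R_iff[of x y "snd x"] R_iff[of y x "snd x"] incomp_sym[of x y] by auto
  qed
  have R_le: "R x y \<longleftrightarrow> R z y" if H: "x \<in> carrier H" "y \<in> carrier H" "z \<in> carrier H"
    and inc: "incomp x y" "incomp y z" and "x \<sqsubseteq> z" for x y z
  proof -
    \<comment> \<open>The chosen paths of \<open>x\<close> and \<open>z\<close> may differ, but each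
      matters only at its own element, where its value is forced. So a single path through both can
      replace them.\<close>
    obtain D G where D: "chain_path b u D G" "x \<in> D" "z \<in> D"
      using through H \<open>x \<sqsubseteq> z\<close> by blast
    have "G (snd x) = F x (snd x)" "G (snd z) = F z (snd z)"
      using D F_snd H by (auto simp: chain_path_def)
    then show ?thesis
      using chain_paths_same_side_comparable(1)[OF D(1) _ D(2,3) _ inc \<open>x \<sqsubseteq> z\<close>, of "C y" "F y"] path[OF H(2)]
        R_iff[OF H(1,2) inc(1), of "snd x"] R_iff[OF H(3,2), of "snd z"] inc incomp_sym by auto
  qed
  have R_trans: "R x z" if H: "x \<in> carrier H" "y \<in> carrier H" "z \<in> carrier H" and "R x y" "R y z" for x y z
  proof -
    have inc: "incomp x y" "incomp y z"
      using that R_incomp by auto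
    \<comment> \<open>If \<open>x\<close> and \<open>z\<close> were comparable, \<open>R_le\<close>
      would turn \<open>R x y\<close> into \<open>R z y\<close>, against
      \<open>R y z\<close>.\<close>
    have xz: "incomp x z"
      using R_le[OF H inc] R_le[of z y x] R_asym \<open>R x y\<close> \<open>R y z\<close> H inc incomp_sym
      unfolding incomp_def[of x z] by blast
    have "snd x \<in> closed_segment (snd y) (snd z) \<or> snd y \<in> closed_segment (snd x) (snd z)
        \<or> snd z \<in> closed_segment (snd x) (snd y)"
      by (auto simp: closed_segment_eq_real_ivl)
    \<comment> \<open>All three paths can be compared at the height of the middle one of the three points.\<close>
    then obtain t where "t \<in> closed_segment (snd x) (snd y)" "t \<in> closed_segment (snd y) (snd z)"
      "t \<in> closed_segment (snd x) (snd z)"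
      by (metis closed_segment_commute ends_in_segment)
    then show ?thesis
      using R_iff inc xz H \<open>R x y\<close> \<open>R y z\<close> by (meson order_less_trans)
  qed
  have "complementary_order H R"
    unfolding complementary_order_def strict_order_on_def
  proof (intro conjI ballI impI)
    show "irreflp_on (carrier H) R"
      by (auto simp: irreflp_on_def R_def)
    show "transp_on (carrier H) R"
      using R_trans by (blast intro: transp_onI)
    show "(x \<sqsubset> y \<or> y \<sqsubset> x) \<noteq> (R x y \<or> R y x)"
      if "x \<in> carrier H" "y \<in> carrier H" "x \<noteq> y" for x y
      using that R_total[of x y] R_incomp[of x y] R_incomp[of y x] unfolding lless_eq incomp_def by blast
  qed
  then show ?thesis by blast
qed

lemma planar_imp_complementary_order:
  assumes "lattice L" "planar L"
  shows "\<exists>R. complementary_order L R"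
proof -
  interpret lattice L by fact
  obtain H f where H: "planar_lattice_diagram H" and f: "bij_betw f (carrier L) (carrier H)"
    "order_emb L H f"
    using assms(2) by (auto simp: planar_def order_isomorphic_def)
  interpret H: planar_lattice_diagram H by fact
  obtain R where R: "complementary_order H R"
    using H.complementary_order_exists by blast
  have mem: "f x \<in> carrier H" if "x \<in> carrier L" for x
    using f(1) that by (auto simp: bij_betw_def)
  have inj: "f x = f y \<longleftrightarrow> x = y" if "x \<in> carrier L" "y \<in> carrier L" for x y
    using f(1) that by (auto simp: bij_betw_def inj_on_eq_iff)
  have less: "f x \<sqsubset>\<^bsub>H\<^esub> f y \<longleftrightarrow> x \<sqsubset>\<^bsub>L\<^esub> y" if "x \<in> carrier L" "y \<in> carrier L" for x y
    using f(2) inj that by (auto simp: order_emb_def lless_eq H.lless_eq)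
  have "complementary_order L (\<lambda>x y. R (f x) (f y))"
    unfolding complementary_order_def strict_order_on_def
  proof (intro conjI ballI impI)
    show "irreflp_on (carrier L) (\<lambda>x y. R (f x) (f y))"
      using R mem by (simp add: complementary_order_def strict_order_on_def irreflp_on_def)
    have "transp_on (carrier H) R"
      using R by (simp add: complementary_order_def strict_order_on_def)
    then show "transp_on (carrier L) (\<lambda>x y. R (f x) (f y))"
      using mem by (intro transp_onI) (rule transp_onD)
    show "(x \<sqsubset>\<^bsub>L\<^esub> y \<or> y \<sqsubset>\<^bsub>L\<^esub> x) \<noteq> (R (f x) (f y) \<or> R (f y) (f x))"
      if "x \<in> carrier L" "y \<in> carrier L" "x \<noteq> y" for x y
      using R mem inj less that unfolding complementary_order_def by metis
  qed
  then show ?thesis by blast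
qed

theorem theorem1:
  fixes L :: "('a, 'b) gorder_scheme"
  assumes "lattice L" and "finite (carrier L)"
  shows "planar L \<longleftrightarrow> (\<exists>R. complementary_order L R)"
  using assms planar_imp_complementary_order complementary_order_imp_planar by blast

end
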